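(* Let $G$ be a graph containing no triangle $K_3$ and no induced path $P_5$ on five vertices. Then $z(G)\le 3$.
   Context: A proper coloring with colors $1,\dots,k$ is a Grundy coloring if for any $i<j$, every vertex of color $j$ has a neighbor of color $i$. A vertex of color $i$ is color-dominating if it has a neighbor of every other color $j\neq i$ used. A $z$-coloring of $G$ is a proper coloring using $k$ colors which is a Grundy coloring, in which every color class contains a color-dominating vertex, and which contains color-dominating vertices $u_1,\dots,u_k$ with $u_j$ of color $j$ and $u_k$ adjacent to $u_j$ for every $j\neq k$. $z(G)$ is the maximum number of colors in a $z$-coloring of $G$. *)

theory Defs
  imports "Graph_Theory.Kuratowski"
begin

(* Finite simple undirected graphs are the symmetric loop-free digraphs of the locale pair_graph:
   u and v are adjacent iff (u, v) \<in> parcs G. *)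

definition triangle_free :: "'a pair_pre_digraph \<Rightarrow> bool" where
  "triangle_free G \<longleftrightarrow>
    \<not> (\<exists>H :: 'a pair_pre_digraph. subgraph (with_proj H) (with_proj G) \<and> K\<^bsub>3\<^esub> (with_proj H))"

(* n counts the vertices of the path, not its edges. *)
definition path_graph :: "nat \<Rightarrow> 'a pair_pre_digraph \<Rightarrow> bool" where
  "path_graph n H \<longleftrightarrow>
    (\<exists>v :: nat \<Rightarrow> 'a. bij_betw v {..<n} (pverts H) \<and>
       parcs H = {(v i, v j) | i j. i < n \<and> j < n \<and> (j = Suc i \<or> i = Suc j)})"

definition induced_path_free :: "nat \<Rightarrow> 'a pair_pre_digraph \<Rightarrow> bool" where
  "induced_path_free n G \<longleftrightarrow>
    \<not> (\<exists>H :: 'a pair_pre_digraph.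
         induced_subgraph (with_proj H) (with_proj G) \<and> path_graph n H)"

(* All k colors 1, ..., k occur; the values of c outside the vertex set are irrelevant. *)
definition proper_coloring :: "'a pair_pre_digraph \<Rightarrow> nat \<Rightarrow> ('a \<Rightarrow> nat) \<Rightarrow> bool" where
  "proper_coloring G k c \<longleftrightarrow>
    c ` pverts G = {1..k} \<and> (\<forall>(u, v) \<in> parcs G. c u \<noteq> c v)"

definition grundy_coloring :: "'a pair_pre_digraph \<Rightarrow> nat \<Rightarrow> ('a \<Rightarrow> nat) \<Rightarrow> bool" where
  "grundy_coloring G k c \<longleftrightarrow>
    proper_coloring G k c \<and>
    (\<forall>i \<in> {1..k}. \<forall>j \<in> {1..k}. i < j \<longrightarrow>
       (\<forall>u \<in> pverts G. c u = j \<longrightarrow> (\<exists>w. (u, w) \<in> parcs G \<and> c w = i)))"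

definition color_dominating :: "'a pair_pre_digraph \<Rightarrow> ('a \<Rightarrow> nat) \<Rightarrow> 'a \<Rightarrow> bool" where
  "color_dominating G c u \<longleftrightarrow>
    u \<in> pverts G \<and>
    (\<forall>j \<in> c ` pverts G. j \<noteq> c u \<longrightarrow> (\<exists>w. (u, w) \<in> parcs G \<and> c w = j))"

definition z_coloring :: "'a pair_pre_digraph \<Rightarrow> nat \<Rightarrow> ('a \<Rightarrow> nat) \<Rightarrow> bool" where
  "z_coloring G k c \<longleftrightarrow>
    grundy_coloring G k c \<and>
    (\<forall>j \<in> {1..k}. \<exists>u. color_dominating G c u \<and> c u = j) \<and>
    (\<exists>u :: nat \<Rightarrow> 'a.
       (\<forall>j \<in> {1..k}. color_dominating G c (u j) \<and> c (u j) = j) \<and>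
       (\<forall>j \<in> {1..k}. j \<noteq> k \<longrightarrow> (u k, u j) \<in> parcs G))"

(* The set is finite (k is at most the number of vertices) and nonempty: every finite graph has
   a z-coloring with its chromatic number of colors. For the graph without vertices it is {0}. *)
definition z_number :: "'a pair_pre_digraph \<Rightarrow> nat" where
  "z_number G = Max {k. \<exists>c. z_coloring G k c}"

end

(* Let u be a vertex of top color adjacent to color-dominating vertices x1, x2, x3 of three other
   colors 1, 2, 3. If z is an l-colored neighbor of xi and z' an l-colored neighbor of xj, where
   {i, j, l} = {1, 2, 3}, then z - xi - u - xj - z' is an induced path unless z or z' is adjacent
   to both xi and xj. So xi and xj have a common neighbor zl of color l, for every l. If zi and zj
   were not adjacent, then zi - xj - u - xi - zj would be an induced path; hence z1, z2, z3 form a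
   triangle.

   Since z_number is a maximum, a z-coloring must also be exhibited. Among all proper colorings
   with the least possible number k of colors, minimize first the number of vertices of color k and
   then the sum of all colors. The latter gives the Grundy property. If a vertex u of color k had
   no color-dominating neighbor of color j, then all its neighbors of color j could be moved to a
   color missing in their neighborhood, and u to color j, contradicting the former. *)

theory Submission
  imports Defs
begin

section \<open>Triangles and induced paths\<close>

context pair_graph
begin

lemma triangle_not_triangle_free:
  assumes "(a, b) \<in> parcs G" "(b, c) \<in> parcs G" "(a, c) \<in> parcs G"
  shows "\<not> triangle_free G"
proof -
  define H where "H = \<lparr>pverts = {a, b, c}, parcs = {(u, v). u \<in> {a, b, c} \<and> v \<in> {a, b, c} \<and> u \<noteq> v}\<rparr>"
  have ne: "a \<noteq> b" "b \<noteq> c" "a \<noteq> c" using assms no_loops' by auto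
  then have K: "K\<^bsub>3\<^esub> (with_proj H)"
    unfolding complete_digraph_pair_def by (auto simp: H_def)
  then have "pair_graph H" by (rule pair_graphI_complete)
  then interpret H: pair_graph H .
  have "pverts H \<subseteq> pverts G" using assms in_arcsD1 in_arcsD2 by (auto simp: H_def)
  moreover have "parcs H \<subseteq> parcs G" using assms arcs_symmetric by (auto simp: H_def)
  ultimately have "subgraph (with_proj H) (with_proj G)"
    by (intro subgraphI compatibleI_with_proj) (auto intro: H.wf_digraph wf_digraph)
  then show ?thesis using K unfolding triangle_free_def by blast
qed

text \<open>The subgraph \<open>H\<close> spanned by the image of \<open>v\<close> is induced by
  construction. This reduces the search for an induced path to checking adjacencies along a sequence
  of vertices.\<close>

lemma induced_path_not_induced_path_free:
  assumes inj: "inj_on v {..<n}" and verts: "v ` {..<n} \<subseteq> pverts G"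
    and arcs: "\<And>i j. i < n \<Longrightarrow> j < n \<Longrightarrow> (v i, v j) \<in> parcs G \<longleftrightarrow> j = Suc i \<or> i = Suc j"
  shows "\<not> induced_path_free n G"
proof -
  define H where
    "H = \<lparr>pverts = v ` {..<n}, parcs = {e \<in> parcs G. fst e \<in> v ` {..<n} \<and> snd e \<in> v ` {..<n}}\<rparr>"
  have "pair_wf_digraph H" by unfold_locales (auto simp: H_def)
  then have "wf_digraph (with_proj H)" by (simp add: wf_digraph_wp_iff)
  then have "induced_subgraph (with_proj H) (with_proj G)"
    using verts by (intro induced_subgraphI subgraphI compatibleI_with_proj)
      (auto simp: H_def intro: wf_digraph)
  moreover have "path_graph n H"
    unfolding path_graph_def
  proof (intro exI conjI)
    show "bij_betw v {..<n} (pverts H)" using inj by (simp add: H_def bij_betw_def)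
    show "parcs H = {(v i, v j) | i j. i < n \<and> j < n \<and> (j = Suc i \<or> i = Suc j)}"
      using arcs by (fastforce simp: H_def)
  qed
  ultimately show ?thesis unfolding induced_path_free_def by blast
qed

lemma induced_P5_not_induced_path_free:
  assumes "(a, b) \<in> parcs G" "(b, c) \<in> parcs G" "(c, d) \<in> parcs G" "(d, e) \<in> parcs G"
    and "(a, c) \<notin> parcs G" "(a, d) \<notin> parcs G" "(a, e) \<notin> parcs G"
      "(b, d) \<notin> parcs G" "(b, e) \<notin> parcs G" "(c, e) \<notin> parcs G"
    and "distinct [a, b, c, d, e]"
  shows "\<not> induced_path_free 5 G"
proof (rule induced_path_not_induced_path_free[where v = "(!) [a, b, c, d, e]"])
  have five: "{..<5} = {0, 1, 2, 3, 4 :: nat}" by auto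
  show "inj_on ((!) [a, b, c, d, e]) {..<5}" using assms(11) by (auto simp: inj_on_nth)
  show "(!) [a, b, c, d, e] ` {..<5} \<subseteq> pverts G"
    using assms(1-4) in_arcsD1 in_arcsD2 by (auto simp: five)
  fix i j :: nat
  assume "i < 5" "j < 5"
  then have "i \<in> {0, 1, 2, 3, 4}" "j \<in> {0, 1, 2, 3, 4}" by auto
  moreover have irrefl: "(x, x) \<notin> parcs G" for x using no_loops' by blast
  moreover have rev: "(b, a) \<in> parcs G" "(c, b) \<in> parcs G" "(d, c) \<in> parcs G" "(e, d) \<in> parcs G"
    "(c, a) \<notin> parcs G" "(d, a) \<notin> parcs G" "(e, a) \<notin> parcs G"
    "(d, b) \<notin> parcs G" "(e, b) \<notin> parcs G" "(e, c) \<notin> parcs G"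
    using assms(1-10) arcs_symmetric by blast+
  ultimately show
    "([a, b, c, d, e] ! i, [a, b, c, d, e] ! j) \<in> parcs G \<longleftrightarrow> j = Suc i \<or> i = Suc j"
    by (elim insertE emptyE) (simp_all add: assms(1-10))
qed

section \<open>The upper bound\<close>

text \<open>Otherwise z - x - u - y - z' is an induced path on five vertices. The lemma serves
  twice: for \<open>z\<close> and \<open>z'\<close> of equal color it forces a common neighbor of
  \<open>x\<close> and \<open>y\<close>, and for \<open>z\<close> colored like \<open>y\<close> and
  \<open>z'\<close> colored like \<open>x\<close> it yields an edge.\<close>

lemma private_neighbors_adjacent:
  assumes tf: "triangle_free G" and pf: "induced_path_free 5 G"
    and ux: "(u, x) \<in> parcs G" and uy: "(u, y) \<in> parcs G"
    and xz: "(x, z) \<in> parcs G" "(y, z) \<notin> parcs G"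
    and yz: "(y, z') \<in> parcs G" "(x, z') \<notin> parcs G"
  shows "(z, z') \<in> parcs G"
proof (rule ccontr)
  assume none: "(z, z') \<notin> parcs G"
  have sym: "(z, x) \<in> parcs G" "(x, u) \<in> parcs G" "(y, u) \<in> parcs G"
    using xz ux uy by (auto intro: arcs_symmetric)
  \<comment> \<open>These edges would close the triangles u x y, u x z and u y z'
    respectively.\<close>
  have far: "(x, y) \<notin> parcs G" "(u, z) \<notin> parcs G" "(u, z') \<notin> parcs G"
    using triangle_not_triangle_free tf ux uy xz yz by blast+
  then have "(z, u) \<notin> parcs G" "(z, y) \<notin> parcs G" using xz arcs_symmetric by blast+
  moreover have "distinct [z, x, u, y, z']"
    using far sym xz yz ux uy by (auto dest: no_loops')
  ultimately show False
    using induced_P5_not_induced_path_free[of z x u y z'] pf sym uy yz none far by blast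
qed

lemma z_coloring_le_3:
  assumes tf: "triangle_free G" and pf: "induced_path_free 5 G" and z: "z_coloring G k c"
  shows "k \<le> 3"
proof (rule ccontr)
  assume "\<not> k \<le> 3"
  then have k: "3 < k" by simp
  have colors: "c ` pverts G = {1..k}" and proper: "\<And>x y. (x, y) \<in> parcs G \<Longrightarrow> c x \<noteq> c y"
    using z unfolding z_coloring_def grundy_coloring_def proper_coloring_def by auto
  obtain u :: "nat \<Rightarrow> 'a" where dom: "\<And>j. j \<in> {1..k} \<Longrightarrow> color_dominating G c (u j)"
    and col: "\<And>j. j \<in> {1..k} \<Longrightarrow> c (u j) = j"
    and adj: "\<And>j. j \<in> {1..k} \<Longrightarrow> j \<noteq> k \<Longrightarrow> (u k, u j) \<in> parcs G"
    using z unfolding z_coloring_def by blast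
  have nb: "\<exists>w. (u i, w) \<in> parcs G \<and> c w = j" if "i \<in> {1..k}" "j \<in> {1..k}" "j \<noteq> i" for i j
    using dom[OF that(1)] col[OF that(1)] that colors unfolding color_dominating_def by auto
  have common: "\<exists>w. (u i, w) \<in> parcs G \<and> (u j, w) \<in> parcs G \<and> c w = l"
    if ijl: "i \<in> {1..k}" "j \<in> {1..k}" "l \<in> {1..k}" "i \<noteq> k" "j \<noteq> k" "l \<noteq> i" "l \<noteq> j" for i j l
  proof -
    obtain w w' where w: "(u i, w) \<in> parcs G" "c w = l" and w': "(u j, w') \<in> parcs G" "c w' = l"
      using nb ijl by metis
    then have "(w, w') \<notin> parcs G" using proper by metis
    \<comment> \<open>Two nonadjacent vertices cannot both be private neighbors, so \<open>w\<close>
      or \<open>w'\<close> is a common one.\<close>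
    then have "(u j, w) \<in> parcs G \<or> (u i, w') \<in> parcs G"
      using private_neighbors_adjacent[OF tf pf adj adj w(1) _ w'(1)] ijl by blast
    then show ?thesis using w w' by blast
  qed
  have adjacent: "(w, w') \<in> parcs G"
    if ij: "i \<in> {1..k}" "j \<in> {1..k}" "i \<noteq> k" "j \<noteq> k"
      and w: "(u i, w) \<in> parcs G" "c w = j" and w': "(u j, w') \<in> parcs G" "c w' = i" for i j w w'
  proof (rule private_neighbors_adjacent[OF tf pf adj adj w(1) _ w'(1)])
    \<comment> \<open>An edge from \<open>u j\<close> to \<open>w\<close> would join two vertices of
      color \<open>j\<close>, and one from \<open>u i\<close> to \<open>w'\<close> two of color
      \<open>i\<close>.\<close>
    show "(u j, w) \<notin> parcs G" "(u i, w') \<notin> parcs G" using proper col ij w(2) w'(2) by metis+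
  qed (use ij in auto)
  \<comment> \<open>Here \<open>3 < k\<close> enters: the colors 1, 2, 3 all differ from
    \<open>k\<close>, so \<open>u 1\<close>, \<open>u 2\<close>, \<open>u 3\<close> are neighbors of
    \<open>u k\<close>.\<close>
  obtain z1 where z1: "(u 2, z1) \<in> parcs G" "(u 3, z1) \<in> parcs G" "c z1 = 1"
    using common[of 2 3 1] k by auto
  obtain z2 where z2: "(u 1, z2) \<in> parcs G" "(u 3, z2) \<in> parcs G" "c z2 = 2"
    using common[of 1 3 2] k by auto
  obtain z3 where z3: "(u 1, z3) \<in> parcs G" "(u 2, z3) \<in> parcs G" "c z3 = 3"
    using common[of 1 2 3] k by auto
  have "(z1, z2) \<in> parcs G" using adjacent[of 2 1] z1 z2 k by simp
  moreover have "(z2, z3) \<in> parcs G" using adjacent[of 3 2] z2 z3 k by simp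
  moreover have "(z1, z3) \<in> parcs G" using adjacent[of 3 1] z1 z3 k by simp
  ultimately show False using triangle_not_triangle_free tf by blast
qed

section \<open>Existence of a z-coloring\<close>

definition coloring_into :: "nat \<Rightarrow> ('a \<Rightarrow> nat) \<Rightarrow> bool" where
  "coloring_into k c \<longleftrightarrow> c ` pverts G \<subseteq> {1..k} \<and> (\<forall>(u, v) \<in> parcs G. c u \<noteq> c v)"

lemma coloring_intoD:
  assumes "coloring_into k c"
  shows "v \<in> pverts G \<Longrightarrow> c v \<in> {1..k}" and "(u, v) \<in> parcs G \<Longrightarrow> c u \<noteq> c v"
  using assms unfolding coloring_into_def by auto

lemma coloring_intoI:
  assumes "\<And>v. v \<in> pverts G \<Longrightarrow> c v \<in> {1..k}" and "\<And>u v. (u, v) \<in> parcs G \<Longrightarrow> c u \<noteq> c v"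
  shows "coloring_into k c"
  using assms unfolding coloring_into_def by auto

lemma ex_coloring_into: "\<exists>k c. coloring_into k c"
proof -
  obtain f :: "'a \<Rightarrow> nat" where f: "inj_on f (pverts G)"
    using finite_imp_inj_to_nat_seg[OF pair_finite_verts] by blast
  \<comment> \<open>An injective numbering is proper; \<open>Suc\<close> makes the colors start at
    1.\<close>
  have "coloring_into (Suc (Max (f ` pverts G))) (Suc \<circ> f)"
  proof (rule coloring_intoI)
    fix v assume "v \<in> pverts G"
    then show "(Suc \<circ> f) v \<in> {1..Suc (Max (f ` pverts G))}" using pair_finite_verts by simp
  next
    fix u v assume "(u, v) \<in> parcs G"
    then have "u \<noteq> v" "u \<in> pverts G" "v \<in> pverts G" using no_loops' in_arcsD1 in_arcsD2 by blast+
    then show "(Suc \<circ> f) u \<noteq> (Suc \<circ> f) v" using f by (auto dest: inj_onD)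
  qed
  then show ?thesis by blast
qed

lemma coloring_into_omitted:
  assumes c: "coloring_into k c" and i: "i \<in> {1..k}" "i \<notin> c ` pverts G"
  shows "coloring_into (k - 1) (\<lambda>v. if c v = k then i else c v)"
proof (rule coloring_intoI)
  fix v assume v: "v \<in> pverts G"
  then have "c v \<in> {1..k}" "c v \<noteq> i" using coloring_intoD(1)[OF c] i by auto
  then show "(if c v = k then i else c v) \<in> {1..k - 1}" using i by auto
next
  fix u v assume uv: "(u, v) \<in> parcs G"
  then have "c u \<noteq> c v" "c u \<noteq> i" "c v \<noteq> i"
    using coloring_intoD(2)[OF c] i in_arcsD1 in_arcsD2 by auto
  then show "(if c u = k then i else c u) \<noteq> (if c v = k then i else c v)" by auto
qed

lemma coloring_into_upd:
  assumes c: "coloring_into k c" and i: "i \<in> {1..k}"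
    and free: "\<And>w. (u, w) \<in> parcs G \<Longrightarrow> c w \<noteq> i"
  shows "coloring_into k (c(u := i))"
proof (rule coloring_intoI)
  fix v assume "v \<in> pverts G"
  then show "(c(u := i)) v \<in> {1..k}" using coloring_intoD(1)[OF c] i by auto
next
  fix v w assume vw: "(v, w) \<in> parcs G"
  have "c v \<noteq> c w" "v \<noteq> w" using coloring_intoD(2)[OF c vw] no_loops'[OF vw] by auto
  moreover have "v = u \<Longrightarrow> c w \<noteq> i" "w = u \<Longrightarrow> c v \<noteq> i"
    using free vw arcs_symmetric[OF vw] by auto
  ultimately show "(c(u := i)) v \<noteq> (c(u := i)) w" by auto
qed

text \<open>The \<open>j\<close>-colored neighbors of \<open>u\<close> are pairwise nonadjacent, so
  all can move at once: a neighbor of such a \<open>w\<close> is either \<open>u\<close>, now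
  colored \<open>j\<close>, or keeps a color different from \<open>m w\<close>.\<close>

lemma coloring_into_swap:
  assumes c: "coloring_into k c" and j: "j \<in> {1..k}"
    and m: "\<And>w. (u, w) \<in> parcs G \<Longrightarrow> c w = j \<Longrightarrow> m w \<in> {1..k} \<and> m w \<noteq> j"
    and free: "\<And>w y. (u, w) \<in> parcs G \<Longrightarrow> c w = j \<Longrightarrow> (w, y) \<in> parcs G \<Longrightarrow> c y \<noteq> m w"
  shows "coloring_into k (\<lambda>v. if v = u then j else if (u, v) \<in> parcs G \<and> c v = j then m v else c v)"
    (is "coloring_into k ?c")
proof (rule coloring_intoI)
  fix v assume "v \<in> pverts G"
  then show "?c v \<in> {1..k}" using coloring_intoD(1)[OF c] j m by auto
next
  fix a b assume ab: "(a, b) \<in> parcs G"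
  then have ba: "(b, a) \<in> parcs G" by (rule arcs_symmetric)
  have ne: "c a \<noteq> c b" "a \<noteq> b" using coloring_intoD(2)[OF c ab] no_loops'[OF ab] by auto
  have ma: "m a \<noteq> j \<and> m a \<noteq> c b" if "(u, a) \<in> parcs G" "c a = j"
    using m[OF that] free[OF that ab] by simp
  have mb: "m b \<noteq> j \<and> m b \<noteq> c a" if "(u, b) \<in> parcs G" "c b = j"
    using m[OF that] free[OF that ba] by simp
  consider "a = u" | "b = u" | "a \<noteq> u" "b \<noteq> u" by blast
  then show "?c a \<noteq> ?c b"
  proof cases
    case 1
    then have "?c a = j" "?c b = (if c b = j then m b else c b)" using ab ne by auto
    then show ?thesis using mb ab 1 by (cases "c b = j") simp_all
  next
    case 2
    then have "?c b = j" "?c a = (if c a = j then m a else c a)" using ba ne by auto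
    then show ?thesis using ma ba 2 by (cases "c a = j") simp_all
  next
    case 3
    then show ?thesis
      using ma mb ne(1) by (simp, metis)
  qed
qed

text \<open>The relation \<open>measures\<close> compares lexicographically, first the size of class
  \<open>k\<close> and then the sum of colors. It is well-founded, so a minimal coloring
  exists.\<close>

lemma ex_optimal_coloring:
  "\<exists>k c. coloring_into k c \<and> (\<forall>k' c'. coloring_into k' c' \<longrightarrow> k \<le> k') \<and>
    (\<forall>c'. coloring_into k c' \<longrightarrow>
      (c', c) \<notin> measures [\<lambda>c. card {v \<in> pverts G. c v = k}, \<lambda>c. \<Sum>v \<in> pverts G. c v])"
proof -
  define k where "k = (LEAST k. \<exists>c. coloring_into k c)"
  have k: "\<exists>c. coloring_into k c"
    unfolding k_def by (rule LeastI_ex) (rule ex_coloring_into)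
  have min: "k \<le> k'" if "coloring_into k' c'" for k' c'
    unfolding k_def using that by (intro Least_le) blast
  define R where
    "R = measures [\<lambda>c. card {v \<in> pverts G. c v = k}, \<lambda>c. \<Sum>v \<in> pverts G. c v]"
  have "wf R" by (simp add: R_def)
  then obtain c where "coloring_into k c" "\<forall>c'. coloring_into k c' \<longrightarrow> (c', c) \<notin> R"
    using k unfolding wf_eq_minimal by (metis mem_Collect_eq)
  then show ?thesis using min unfolding R_def by blast
qed

lemma ex_z_coloring: "\<exists>k c. z_coloring G k c"
proof -
  obtain k c where c: "coloring_into k c"
    and min: "\<forall>k' c'. coloring_into k' c' \<longrightarrow> k \<le> k'"
    and opt: "\<forall>c'. coloring_into k c' \<longrightarrow>
      (c', c) \<notin> measures [\<lambda>c. card {v \<in> pverts G. c v = k}, \<lambda>c. \<Sum>v \<in> pverts G. c v]"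
    using ex_optimal_coloring by (elim exE conjE) (rule that)
  have "{1..k} \<subseteq> c ` pverts G"
  proof
    fix i assume i: "i \<in> {1..k}"
    show "i \<in> c ` pverts G"
    proof (rule ccontr)
      assume "i \<notin> c ` pverts G"
      then have "k \<le> k - 1" using min coloring_into_omitted[OF c i] by blast
      then show False using i by auto
    qed
  qed
  then have colors: "c ` pverts G = {1..k}" using coloring_intoD(1)[OF c] by auto
  then have proper: "proper_coloring G k c"
    using c unfolding proper_coloring_def coloring_into_def by auto
  have grundy: "\<exists>w. (u, w) \<in> parcs G \<and> c w = i"
    if u: "u \<in> pverts G" and i: "i \<in> {1..k}" "i < c u" for u i
  proof (rule ccontr)
    assume "\<nexists>w. (u, w) \<in> parcs G \<and> c w = i"
    then have c': "coloring_into k (c(u := i))" using coloring_into_upd[OF c i(1)] by blast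
    have "c u \<le> k" using coloring_intoD(1)[OF c u] by simp
    \<comment> \<open>Since \<open>i < c u\<close> and \<open>c u \<le> k\<close>, the vertex
      \<open>u\<close> cannot enter the top class. The first measure does not grow while the sum
      strictly drops.\<close>
    then have "{v \<in> pverts G. (c(u := i)) v = k} \<subseteq> {v \<in> pverts G. c v = k}" using i by auto
    then have "card {v \<in> pverts G. (c(u := i)) v = k} \<le> card {v \<in> pverts G. c v = k}"
      using pair_finite_verts by (intro card_mono) auto
    moreover have "(\<Sum>v \<in> pverts G. (c(u := i)) v) < (\<Sum>v \<in> pverts G. c v)"
      using pair_finite_verts u i by (intro sum_strict_mono_ex1) auto
    ultimately show False using opt[rule_format, OF c'] by auto
  qed
  have top: "\<exists>w. (u, w) \<in> parcs G \<and> color_dominating G c w \<and> c w = j"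
    if u: "u \<in> pverts G" "c u = k" and j: "j \<in> {1..k}" "j \<noteq> k" for u j
  proof (rule ccontr)
    assume none: "\<nexists>w. (u, w) \<in> parcs G \<and> color_dominating G c w \<and> c w = j"
    \<comment> \<open>Such a \<open>w\<close> is not color-dominating, so some color besides its own
      is missing among its neighbors.\<close>
    have "\<exists>i. i \<in> {1..k} \<and> i \<noteq> j \<and> (\<forall>y. (w, y) \<in> parcs G \<longrightarrow> c y \<noteq> i)"
      if "(u, w) \<in> parcs G" "c w = j" for w
      using none that colors in_arcsD2 unfolding color_dominating_def by metis
    then obtain m where m: "\<And>w. (u, w) \<in> parcs G \<Longrightarrow> c w = j \<Longrightarrow>
        m w \<in> {1..k} \<and> m w \<noteq> j \<and> (\<forall>y. (w, y) \<in> parcs G \<longrightarrow> c y \<noteq> m w)"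
      by metis
    let ?c = "\<lambda>v. if v = u then j else if (u, v) \<in> parcs G \<and> c v = j then m v else c v"
    have c': "coloring_into k ?c" using m by (intro coloring_into_swap[OF c j(1)]) blast+
    \<comment> \<open>Each moved \<open>w\<close> sees \<open>u\<close>, which has color
      \<open>k\<close>. So no vertex enters the top class, while \<open>u\<close> leaves it.\<close>
    have "m w \<noteq> k" if "(u, w) \<in> parcs G" "c w = j" for w
      using m[OF that] arcs_symmetric[OF that(1)] u by blast
    then have "{v \<in> pverts G. ?c v = k} \<subset> {v \<in> pverts G. c v = k}"
      using u j by (auto split: if_splits)
    then have "card {v \<in> pverts G. ?c v = k} < card {v \<in> pverts G. c v = k}"
      using pair_finite_verts by (intro psubset_card_mono) auto
    then show False using opt[rule_format, OF c'] by auto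
  qed
  have "z_coloring G k c"
  \<comment> \<open>For \<open>k = 0\<close> the graph has no vertices, and all conditions on
    color-dominating vertices are vacuous.\<close>
  proof (cases "k = 0")
    case True
    then show ?thesis
      using proper unfolding z_coloring_def grundy_coloring_def by simp
  next
    case False
    then have "k \<in> c ` pverts G" using colors by simp
    then obtain x where x: "x \<in> pverts G" "c x = k" by blast
    \<comment> \<open>At the top color all other colors are smaller, so the Grundy property amounts
      to color domination.\<close>
    have dom_x: "color_dominating G c x"
      using grundy[OF x(1)] x colors unfolding color_dominating_def by simp
    obtain f where f: "\<And>j. j \<in> {1..k} \<Longrightarrow> j \<noteq> k \<Longrightarrow>
        (x, f j) \<in> parcs G \<and> color_dominating G c (f j) \<and> c (f j) = j"
      using top[OF x] by metis
    \<comment> \<open>The choice \<open>f\<close> is only constrained below \<open>k\<close>;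
      \<open>x\<close> itself represents color \<open>k\<close>.\<close>
    define u where "u = f(k := x)"
    have dom: "color_dominating G c (u j) \<and> c (u j) = j" if "j \<in> {1..k}" for j
      using f[OF that] dom_x x by (auto simp: u_def)
    have adj: "(u k, u j) \<in> parcs G" if "j \<in> {1..k}" "j \<noteq> k" for j
      using f[OF that] that by (simp add: u_def)
    show ?thesis
      unfolding z_coloring_def grundy_coloring_def
    proof (intro conjI ballI impI exI[of _ u])
      show "\<exists>v. color_dominating G c v \<and> c v = j" if "j \<in> {1..k}" for j
        using dom[OF that] by blast
    qed (use proper grundy dom adj in simp_all)
  qed
  then show ?thesis by blast
qed

end

theorem theorem3:
  fixes G :: "'a pair_pre_digraph"
  assumes "pair_graph G"
    and "triangle_free G"
    and "induced_path_free 5 G"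
  shows "z_number G \<le> 3"
proof -
  interpret pair_graph G by fact
  have bound: "{k. \<exists>c. z_coloring G k c} \<subseteq> {..3}"
    using z_coloring_le_3 assms(2,3) by auto
  then have "finite {k. \<exists>c. z_coloring G k c}" by (rule finite_subset) simp
  \<comment> \<open>Only for a finite nonempty set is \<open>Max\<close> known to be an element,
    hence the existence of a z-coloring.\<close>
  then have "Max {k. \<exists>c. z_coloring G k c} \<in> {k. \<exists>c. z_coloring G k c}"
    using ex_z_coloring by (intro Max_in) auto
  then show ?thesis using bound unfolding z_number_def by auto
qed

end
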